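(* Let $\mathbb F_q$ be a finite field with $q$ elements. Let $d,e,r$ be positive integers and let $\square\subseteq\mathbb R^2$ be the polytope with vertices $(0,0),(d,0),(d,e+rd),(0,e)$. Assume that $d<q-1$, $e<q-1$ and $e+rd<q-1$. Then the toric code $C_\square$ over $\mathbb F_q$ has (1) length equal to $(q-1)^2$; (2) dimension equal to $\#(\mathbb Z^2\cap\square)=(d+1)(e+1)+r\,\frac{d(d+1)}{2}$; (3) minimum distance equal to $$\min\{(q-1-d)(q-1-e),\ (q-1)(q-1-e-rd)\}.$$
   Context: For an integral convex polytope $\square\subseteq\mathbb R^2$, let $U=\mathbb Z^2\cap\square$ and let $\mathbb F_q[U]$ be the $\mathbb F_q$-linear span of the monomials $X_1^{u_1}X_2^{u_2}$, $(u_1,u_2)\in U$, in $\mathbb F_q[X_1^{\pm1},X_2^{\pm1}]$. Let $T(\mathbb F_q)=(\mathbb F_q^* )^2$. The toric code $C_\square$ is the image of the evaluation map $\mathbb F_q[U]\to\mathbb F_q^{|T(\mathbb F_q)|}$, $f\mapsto (f(P))_{P\in T(\mathbb F_q)}$. The minimum distance of a linear code is the minimal number of non-zero coordinates of a non-zero codeword. *)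

theory Defs
  imports "HOL-Analysis.Analysis" "HOL-Library.Poly_Mapping"
begin

section \<open>Laurent polynomials in two variables\<close>

text \<open>The Laurent polynomial ring in two variables over a field is the group algebra of the
  additive group \<open>int \<times> int\<close>:
  finitely supported functions on exponent vectors with the convolution product.\<close>

type_synonym 'a laurent = "(int \<times> int) \<Rightarrow>\<^sub>0 'a"

definition laurent_scale :: "'a::field \<Rightarrow> 'a laurent \<Rightarrow> 'a laurent"
  where "laurent_scale c f = Poly_Mapping.single 0 c * f"

global_interpretation laurent: vector_space "laurent_scale :: 'a::field \<Rightarrow> 'a laurent \<Rightarrow> 'a laurent"
  by standard
    (simp_all add: laurent_scale_def algebra_simps single_add mult_single flip: mult.assoc)

definition laurent_monom :: "int \<times> int \<Rightarrow> 'a::field laurent"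
  where "laurent_monom u = Poly_Mapping.single u 1"

definition laurent_eval :: "'a::field laurent \<Rightarrow> 'a \<times> 'a \<Rightarrow> 'a"
  where "laurent_eval f = (\<lambda>(x, y). \<Sum>(i, j) \<in> Poly_Mapping.keys f.
           Poly_Mapping.lookup f (i, j) * (x powi i * y powi j))"


section \<open>Linear codes\<close>

text \<open>A linear code is a subspace of \<open>'a ^ 'n\<close>; its coordinates are indexed by the type \<open>'n\<close>.\<close>

definition code_length :: "('a::field ^ 'n::finite) set \<Rightarrow> nat"
  where "code_length C = CARD('n)"

definition hamming_weight :: "'a::field ^ 'n::finite \<Rightarrow> nat"
  where "hamming_weight c = card {i. c $ i \<noteq> 0}"

definition min_distance :: "('a::{field,finite} ^ 'n::finite) set \<Rightarrow> nat"
  where "min_distance C = Min (hamming_weight ` (C - {0}))"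


section \<open>Toric codes\<close>

definition lattice_points :: "(real \<times> real) set \<Rightarrow> (int \<times> int) set"
  where "lattice_points P = {(i, j). (real_of_int i, real_of_int j) \<in> P}"

typedef (overloaded) 'a torus = "(UNIV - {0}) \<times> (UNIV - {0}) :: ('a::field \<times> 'a) set"
  by (rule exI[of _ "(1, 1)"]) simp

instance torus :: ("{field,finite}") finite
proof
  have "inj (Rep_torus :: 'a torus \<Rightarrow> 'a \<times> 'a)"
    by (simp add: inj_def Rep_torus_inject)
  then show "finite (UNIV :: 'a torus set)"
    by (rule finite_imageD[rotated]) simp
qed

definition eval_map :: "'a::{field,finite} laurent \<Rightarrow> 'a ^ 'a torus"
  where "eval_map f = (\<chi> t. laurent_eval f (Rep_torus t))"

definition toric_code :: "(real \<times> real) set \<Rightarrow> ('a::{field,finite} ^ 'a torus) set"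
  where "toric_code P = eval_map ` laurent.span (laurent_monom ` lattice_points P)"

end

theory Submission
  imports Defs "HOL-Computational_Algebra.Polynomial"
begin

text \<open>
  If a nonzero \<open>f\<close> supported in the trapezoid vanishes on a line \<open>x = a\<close> with \<open>a \<noteq> 0\<close>, dividing by
  \<open>x - a\<close> leaves a polynomial supported in the trapezoid with \<open>d\<close> replaced by \<open>d - 1\<close>: the lower
  bound for the exponents of \<open>x\<close> next to each \<open>y\<^sup>j\<close> survives because \<open>a \<noteq> 0\<close>. After splitting off \<open>k\<close> such
  lines, the degree in \<open>y\<close> on each remaining line is at most \<open>e + r (d - k)\<close>, so \<open>f\<close> has at least
  \<open>(q - 1 - k) (q - 1 - e - r (d - k))\<close> nonzeros on the torus. This is concave in \<open>k\<close>, hence minimal at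
  \<open>k = 0\<close> or \<open>k = d\<close>; both values are attained by products of a polynomial in \<open>x\<close> and one in \<open>y\<close>.
  Positivity of the bound also shows that evaluation is injective, which gives the dimension.
\<close>

section \<open>Zeros of bivariate polynomials on a grid\<close>

text \<open>The outer variable is y and the coefficients are polynomials in x. Substituting the
  constant polynomial \<open>[:y:]\<close> for the outer variable leaves a polynomial in x.\<close>

definition eval2 :: "'a::comm_ring_1 poly poly \<Rightarrow> 'a \<Rightarrow> 'a \<Rightarrow> 'a"
  where "eval2 G x y = poly (poly G [:y:]) x"

text \<open>Specializing x first gives a univariate polynomial in y on each line of constant x, to
  which the root bound applies.\<close>

lemma eval2_conv_map_poly: "eval2 G x y = poly (map_poly (\<lambda>p. poly p x) G) y"
  unfolding eval2_def
proof (induction G)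
  case (pCons p G)
  then show ?case by (simp add: map_poly_pCons)
qed simp

definition in_trapezoid :: "nat \<Rightarrow> nat \<Rightarrow> nat \<Rightarrow> 'a::comm_ring_1 poly poly \<Rightarrow> bool"
  where "in_trapezoid d e r G \<longleftrightarrow>
    (\<forall>i j. coeff (coeff G j) i \<noteq> 0 \<longrightarrow> i \<le> d \<and> j \<le> e + r * i)"

lemma in_trapezoid_div_linear:
  fixes H :: "'a::field poly poly"
  assumes G: "in_trapezoid d e r (smult [:-a, 1:] H)" and a: "a \<noteq> 0" and H: "H \<noteq> 0"
  shows "d > 0 \<and> in_trapezoid (d - 1) e r H"
proof -
  \<comment> \<open>Multiplication by x - a raises the degree of \<open>coeff H j\<close> by exactly
    one, and the leading exponent of the product is still at most \<open>d\<close>.\<close>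
  have deg: "Suc i \<le> d" if "coeff (coeff H j) i \<noteq> 0" for i j
  proof -
    have nz: "coeff H j \<noteq> 0" using that by auto
    have "[:-a, 1:] * coeff H j \<noteq> 0" using nz by (subst mult_eq_0_iff) auto
    then have "lead_coeff ([:-a, 1:] * coeff H j) \<noteq> 0" by (simp only: leading_coeff_0_iff not_False_eq_True)
    moreover have "degree ([:-a, 1:] * coeff H j) = Suc (degree (coeff H j))"
      using nz by (subst degree_mult_eq) auto
    ultimately have "Suc (degree (coeff H j)) \<le> d"
      using G unfolding in_trapezoid_def by (metis coeff_smult)
    then show ?thesis using le_degree[OF that] by simp
  qed
  \<comment> \<open>With p = \<open>coeff H j\<close>, the product (x - a) p has coefficients -a p_0
    and p_{i-1} - a p_i. Below the bound these vanish, so from p_0 upwards every p_i vanishes in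
    turn because \<open>a\<close> is invertible.\<close>
  have low: "coeff (coeff H j) i = 0" if "e + r * i < j" for i j
    using that
  proof (induction i)
    case 0
    then have "coeff ([:-a, 1:] * coeff H j) 0 = 0"
      using G unfolding in_trapezoid_def by (metis coeff_smult leD)
    then show ?case using a by (simp add: coeff_mult)
  next
    case (Suc i)
    then have "coeff ([:-a, 1:] * coeff H j) (Suc i) = 0"
      using G unfolding in_trapezoid_def by (metis coeff_smult leD)
    moreover have "coeff (coeff H j) i = 0" using Suc by simp
    ultimately show ?case using a by simp
  qed
  obtain i j where "coeff (coeff H j) i \<noteq> 0"
    using H by (metis leading_coeff_0_iff)
  with deg have "d > 0" by fastforce
  moreover have "in_trapezoid (d - 1) e r H"
    unfolding in_trapezoid_def using deg low by (metis Suc_le_mono Suc_pred' calculation leI)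
  ultimately show ?thesis ..
qed

lemma degree_specialize_le:
  assumes "in_trapezoid d e r G"
  shows "degree (map_poly (\<lambda>p. poly p x) G) \<le> e + r * d"
proof (rule degree_le, intro allI impI)
  fix j assume j: "e + r * d < j"
  have "coeff (coeff G j) i = 0" for i
  proof (rule ccontr)
    assume "coeff (coeff G j) i \<noteq> 0"
    then have "i \<le> d" "j \<le> e + r * i" using assms by (auto simp: in_trapezoid_def)
    moreover have "r * i \<le> r * d" using \<open>i \<le> d\<close> by simp
    ultimately show False using j by linarith
  qed
  then have "coeff G j = 0" by (simp add: poly_eq_iff)
  then show "coeff (map_poly (\<lambda>p. poly p x) G) j = 0" by (simp add: coeff_map_poly)
qed

lemma card_nonroots_ge:
  fixes p :: "'a::idom poly"
  assumes "p \<noteq> 0" "finite Y"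
  shows "card Y - degree p \<le> card {y \<in> Y. poly p y \<noteq> 0}"
proof -
  have "{y \<in> Y. poly p y \<noteq> 0} = Y - {y. poly p y = 0}" by auto
  then have "card Y - card {y. poly p y = 0} \<le> card {y \<in> Y. poly p y \<noteq> 0}"
    using diff_card_le_card_Diff poly_roots_finite[OF assms(1)] by metis
  then show ?thesis using card_poly_roots_bound[OF assms(1)] by linarith
qed

text \<open>The number \<open>k\<close> counts the lines \<open>x = a\<close>, \<open>a \<in> X\<close>, on which \<open>G\<close> vanishes identically.\<close>

lemma card_nonzeros_grid_ge:
  fixes G :: "'a::field poly poly"
  assumes "G \<noteq> 0" "in_trapezoid d e r G" "finite X" "finite Y" "0 \<notin> X"
  shows "\<exists>k\<le>d. (card X - k) * (card Y - (e + r * (d - k)))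
    \<le> card {(x, y). x \<in> X \<and> y \<in> Y \<and> eval2 G x y \<noteq> 0}"
  using assms
proof (induction d arbitrary: G X rule: less_induct)
  case (less d)
  show ?case
  proof (cases "\<exists>a\<in>X. map_poly (\<lambda>p. poly p a) G = 0")
    case True
    then obtain a where a: "a \<in> X" "map_poly (\<lambda>p. poly p a) G = 0" by blast
    \<comment> \<open>Vanishing on the whole line means that \<open>a\<close> is a root of every
      coefficient, so x - a divides \<open>G\<close> as a constant of the outer polynomial
      ring.\<close>
    have "[:-a, 1:] dvd coeff G j" for j
      using a(2) by (metis coeff_0 coeff_map_poly poly_0 poly_eq_0_iff_dvd)
    then have "[:[:-a, 1:]:] dvd G" by (simp add: const_poly_dvd_iff)
    then obtain H where "G = [:[:-a, 1:]:] * H" by (elim dvdE)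
    then have H: "G = smult [:-a, 1:] H" by simp
    have nz: "H \<noteq> 0" using H less.prems(1) by auto
    have a0: "a \<noteq> 0" using a(1) less.prems(5) by auto
    have d: "d > 0" and H': "in_trapezoid (d - 1) e r H"
      using in_trapezoid_div_linear[OF _ a0 nz] less.prems(2) H by auto
    obtain k where k: "k \<le> d - 1"
      "(card (X - {a}) - k) * (card Y - (e + r * (d - 1 - k)))
        \<le> card {(x, y). x \<in> X - {a} \<and> y \<in> Y \<and> eval2 H x y \<noteq> 0}"
      using less.IH[of "d - 1" H "X - {a}"] d nz H' less.prems by auto
    have "eval2 G x y = (x - a) * eval2 H x y" for x y
      by (simp add: H eval2_def algebra_simps)
    then have "{(x, y). x \<in> X \<and> y \<in> Y \<and> eval2 G x y \<noteq> 0}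
      = {(x, y). x \<in> X - {a} \<and> y \<in> Y \<and> eval2 H x y \<noteq> 0}" by auto
    \<comment> \<open>The line removed at \<open>a\<close> counts as one more vanishing line:
      \<open>k\<close> for \<open>H\<close> becomes \<open>Suc k\<close> for \<open>G\<close>, and
      \<open>d - 1 - k\<close> equals \<open>d - Suc k\<close>.\<close>
    moreover have "card (X - {a}) - k = card X - Suc k" using a(1) less.prems(3) by simp
    ultimately show ?thesis using k d by (intro exI[of _ "Suc k"]) simp
  next
    case False
    have "card Y - (e + r * d) \<le> card {y \<in> Y. eval2 G x y \<noteq> 0}" if "x \<in> X" for x
      using card_nonroots_ge[of "map_poly (\<lambda>p. poly p x) G" Y] False that less.prems(4)
        degree_specialize_le[OF less.prems(2), of x]
      by (simp add: eval2_conv_map_poly)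
    then have "of_nat (card X) * (card Y - (e + r * d)) \<le> (\<Sum>x\<in>X. card {y \<in> Y. eval2 G x y \<noteq> 0})"
      by (intro sum_bounded_below)
    also have "\<dots> = card (Sigma X (\<lambda>x. {y \<in> Y. eval2 G x y \<noteq> 0}))"
      using less.prems by (subst card_SigmaI) auto
    also have "Sigma X (\<lambda>x. {y \<in> Y. eval2 G x y \<noteq> 0})
      = {(x, y). x \<in> X \<and> y \<in> Y \<and> eval2 G x y \<noteq> 0}" by auto
    finally show ?thesis by (intro exI[of _ 0]) simp
  qed
qed

lemma min_endpoints_le:
  fixes Q d e r k :: nat
  assumes "k \<le> d" "d < Q" "e + r * d < Q"
  shows "min ((Q - d) * (Q - e)) (Q * (Q - e - r * d)) \<le> (Q - k) * (Q - (e + r * (d - k)))"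
proof -
  \<comment> \<open>The slacks \<open>l\<close>, \<open>s\<close>, \<open>m\<close> turn every
    truncated subtraction into a sum; the right-hand side becomes (s + l) (r k + m).\<close>
  obtain l where l: "d = k + l" using assms(1) le_Suc_ex by blast
  obtain s where s: "Q = d + s" using assms(2) by (metis less_imp_add_positive)
  obtain m where m: "Q = e + r * d + m" using assms(3) by (metis less_imp_add_positive)
  have 1: "Q - e = r * k + r * l + m" "Q - e - r * d = m" "Q - (e + r * (d - k)) = r * k + m"
    using m l by (auto simp: algebra_simps)
  have 2: "Q - d = s" "Q - k = s + l" "Q = s + l + k" using s l by auto
  show ?thesis
  \<comment> \<open>The right-hand side exceeds the endpoint value Q m by k (r (s + l) - m), and the
    endpoint value s (r d + m) by l (r k + m - r s). The sign of m - r s decides which difference is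
    certainly nonnegative.\<close>
  proof (cases "m \<le> r * s")
    case True
    then have *: "k * m \<le> k * (r * s)" by simp
    then have "Q * (Q - e - r * d) \<le> (Q - k) * (Q - (e + r * (d - k)))"
      unfolding 1(2,3) 2(2) by (subst 2(3)) (simp add: algebra_simps trans_le_add2[OF *])
    then show ?thesis by linarith
  next
    case False
    then have *: "l * (r * s) \<le> l * m" by simp
    then have "(Q - d) * (Q - e) \<le> (Q - k) * (Q - (e + r * (d - k)))"
      unfolding 1 2(1,2) by (simp add: algebra_simps trans_le_add1[OF *])
    then show ?thesis by linarith
  qed
qed

section \<open>Lattice points of the trapezoid\<close>

definition trapezoid :: "nat \<Rightarrow> nat \<Rightarrow> nat \<Rightarrow> (nat \<times> nat) set"
  where "trapezoid d e r = Sigma {..d} (\<lambda>i. {..e + r * i})"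

lemma finite_trapezoid [simp]: "finite (trapezoid d e r)"
  by (simp add: trapezoid_def)

lemma card_trapezoid: "card (trapezoid d e r) = (d + 1) * (e + 1) + r * (d * (d + 1) div 2)"
proof -
  have "card (trapezoid d e r) = (\<Sum>i\<le>d. (e + 1) + r * i)"
    by (simp add: trapezoid_def)
  also have "\<dots> = (d + 1) * (e + 1) + r * (\<Sum>i\<le>d. i)"
    by (subst sum.distrib) (simp add: sum_distrib_left)
  also have "(\<Sum>i\<le>d. i) = d * (d + 1) div 2"
    using gauss_sum_nat[of d] by (simp add: atMost_atLeast0)
  finally show ?thesis .
qed

text \<open>The region given by the inequalities is convex and contains the four vertices.
  Conversely, it is swept out by vertical segments joining a point of the bottom edge to the point
  of the top edge above it.\<close>

lemma convex_hull_trapezoid: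
  fixes d e r :: nat
  assumes "d > 0"
  shows "convex hull {(0, 0), (real d, 0), (real d, real (e + r * d)), (0, real e)}
    = {(x, y). 0 \<le> x \<and> x \<le> real d \<and> 0 \<le> y \<and> y \<le> real e + real r * x}" (is "?H = ?T")
proof
  have "convex ?T"
  proof (rule convexI)
    fix p p' :: "real \<times> real" and u v :: real
    assume "p \<in> ?T" "p' \<in> ?T" and uv: "0 \<le> u" "0 \<le> v" "u + v = 1"
    then obtain x y x' y' where p: "p = (x, y)" "p' = (x', y')"
      and xy: "0 \<le> x" "x \<le> real d" "0 \<le> y" "y \<le> real e + real r * x"
      and xy': "0 \<le> x'" "x' \<le> real d" "0 \<le> y'" "y' \<le> real e + real r * x'"
      by auto
    note * = uv xy xy'
    have 1: "0 \<le> u * x + v * x'" "0 \<le> u * y + v * y'" using * by simp_all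
    have 2: "u * x + v * x' \<le> real d" using * by (intro convex_bound_le) auto
    have "u * y + v * y' \<le> u * (real e + real r * x) + v * (real e + real r * x')"
      using * by (intro add_mono mult_left_mono) auto
    also have "\<dots> = (u + v) * real e + real r * (u * x + v * x')" by (simp add: algebra_simps)
    finally have "u * y + v * y' \<le> real e + real r * (u * x + v * x')" using * by simp
    with 1 2 show "u *\<^sub>R p + v *\<^sub>R p' \<in> ?T" by (simp add: p)
  qed
  then show "?H \<subseteq> ?T" by (intro hull_minimal) auto
  show "?T \<subseteq> ?H"
  proof clarify
    fix x y :: real
    assume xy: "0 \<le> x" "x \<le> real d" "0 \<le> y" "y \<le> real e + real r * x"
    define s where "s = x / real d"
    have s: "0 \<le> s" "s \<le> 1" "x = s * real d" using xy assms by (auto simp: s_def field_simps)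
    define h where "h = real e + real r * x"
    have "\<exists>t. 0 \<le> t \<and> t \<le> 1 \<and> y = t * h"
    \<comment> \<open>The segment over \<open>x\<close> degenerates to a point when its height is
      zero; then \<open>y\<close> is zero too, and the quotient \<open>y / h\<close> is
      avoided.\<close>
    proof (cases "h = 0")
      case True then show ?thesis using xy by (intro exI[of _ 0]) (auto simp: h_def)
    next
      case False
      then have "h > 0" using xy by (simp add: h_def)
      then show ?thesis using xy by (intro exI[of _ "y / h"]) (auto simp: h_def field_simps)
    qed
    then obtain t where t: "0 \<le> t" "t \<le> 1" "y = t * h" by blast
    have conv: "convex ?H" by (rule convex_convex_hull)
    have in_H: "(0, 0) \<in> ?H" "(real d, 0) \<in> ?H" "(real d, real (e + r * d)) \<in> ?H" "(0, real e) \<in> ?H"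
      by (auto intro: hull_inc)
    have "(1 - s) *\<^sub>R (0, 0) + s *\<^sub>R (real d, 0) \<in> ?H"
      using s in_H by (intro convexD[OF conv]) auto
    then have bot: "(x, 0) \<in> ?H" using s by simp
    have "(1 - s) *\<^sub>R (0, real e) + s *\<^sub>R (real d, real (e + r * d)) \<in> ?H"
      using s in_H by (intro convexD[OF conv]) auto
    moreover have "(1 - s) *\<^sub>R (0, real e) + s *\<^sub>R (real d, real (e + r * d)) = (x, h)"
      using s by (simp add: h_def algebra_simps)
    ultimately have top: "(x, h) \<in> ?H" by simp
    have "(1 - t) *\<^sub>R (x, 0) + t *\<^sub>R (x, h) \<in> ?H"
      using t bot top by (intro convexD[OF conv]) auto
    moreover have "(1 - t) *\<^sub>R (x, 0) + t *\<^sub>R (x, h) = (x, y)"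
      using t by (simp add: algebra_simps)
    ultimately show "(x, y) \<in> ?H" by simp
  qed
qed

text \<open>All exponents in the polytope are nonnegative, so Laurent polynomials can be traded for
  ordinary polynomials with exponents in \<open>nat\<close>.\<close>

lemma lattice_points_trapezoid:
  fixes d e r :: nat
  assumes "d > 0"
  shows "lattice_points (convex hull {(0, 0), (real d, 0), (real d, real (e + r * d)), (0, real e)})
    = map_prod int int ` trapezoid d e r"
proof -
  have "(i, j) \<in> map_prod int int ` trapezoid d e r"
    if "0 \<le> i" "i \<le> int d" "0 \<le> j" "j \<le> int e + int r * i" for i j
  proof -
    obtain k l where "i = int k" "j = int l" using \<open>0 \<le> i\<close> \<open>0 \<le> j\<close> nonneg_int_cases by metis
    moreover have "l \<le> e + r * k"
      using that(4) calculation by (metis of_nat_add of_nat_le_iff of_nat_mult)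
    ultimately show ?thesis using that(2)
      by (intro image_eqI[of _ _ "(k, l)"]) (auto simp: trapezoid_def)
  qed
  moreover have "real_of_int j \<le> real e + real r * real_of_int i \<longleftrightarrow> j \<le> int e + int r * i" for i j
    by (metis of_int_add of_int_le_iff of_int_mult of_int_of_nat_eq)
  moreover have "real_of_int i \<le> real d \<longleftrightarrow> i \<le> int d" for i by linarith
  moreover have "int j \<le> int e + int r * int i \<longleftrightarrow> j \<le> e + r * i" for i j
    by (metis of_nat_add of_nat_le_iff of_nat_mult)
  ultimately show ?thesis
    unfolding lattice_points_def convex_hull_trapezoid[OF assms]
    by (auto simp: trapezoid_def)
qed

section \<open>Toric codes and evaluation of monomials\<close>

text \<open>A common index set containing the supports is needed to compare evaluations of several
  Laurent polynomials, as in the proof of linearity.\<close>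

lemma laurent_eval_conv_sum:
  assumes "finite A" "Poly_Mapping.keys f \<subseteq> A"
  shows "laurent_eval f (x, y)
    = (\<Sum>u\<in>A. Poly_Mapping.lookup f u * (x powi fst u * y powi snd u))"
proof -
  have "laurent_eval f (x, y)
    = (\<Sum>u\<in>Poly_Mapping.keys f. Poly_Mapping.lookup f u * (x powi fst u * y powi snd u))"
    by (simp add: laurent_eval_def case_prod_unfold)
  also have "\<dots> = (\<Sum>u\<in>A. Poly_Mapping.lookup f u * (x powi fst u * y powi snd u))"
    using assms by (intro sum.mono_neutral_left) (auto simp: in_keys_iff)
  finally show ?thesis .
qed

lemma lookup_laurent_scale:
  "Poly_Mapping.lookup (laurent_scale c f) u = c * Poly_Mapping.lookup f u"
proof -
  have "laurent_scale c f = Poly_Mapping.map ((*) c) f"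
    unfolding laurent_scale_def by (rule mult_map_scale_conv_mult[symmetric])
  then show ?thesis by (simp add: Poly_Mapping.map.rep_eq when_def)
qed

lemma eval_map_linear:
  "Vector_Spaces.linear laurent_scale (*s) (eval_map :: 'a::{field,finite} laurent \<Rightarrow> 'a ^ 'a torus)"
proof (unfold_locales)
  fix f g :: "'a laurent" and c :: 'a
  have "laurent_eval (f + g) (x, y) = laurent_eval f (x, y) + laurent_eval g (x, y)" for x y
    by (subst (1 2 3) laurent_eval_conv_sum[of "Poly_Mapping.keys f \<union> Poly_Mapping.keys g"])
      (auto simp: lookup_add algebra_simps sum.distrib dest!: set_mp[OF keys_add])
  then show "eval_map (f + g) = eval_map f + eval_map g"
    by (simp add: eval_map_def vec_eq_iff) (metis prod.collapse)
  have "Poly_Mapping.keys (laurent_scale c f) \<subseteq> Poly_Mapping.keys f"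
    by (auto simp: in_keys_iff lookup_laurent_scale)
  then have "laurent_eval (laurent_scale c f) (x, y) = c * laurent_eval f (x, y)" for x y
    by (subst (1 2) laurent_eval_conv_sum[of "Poly_Mapping.keys f"])
      (auto simp: lookup_laurent_scale sum_distrib_left mult.assoc)
  then show "eval_map (laurent_scale c f) = c *s eval_map f"
    by (simp add: eval_map_def vec_eq_iff) (metis prod.collapse)
qed

definition monom_vec :: "nat \<times> nat \<Rightarrow> 'a::{field,finite} ^ 'a torus"
  where "monom_vec u = (\<chi> t. fst (Rep_torus t) ^ fst u * snd (Rep_torus t) ^ snd u)"

lemma eval_map_laurent_monom: "eval_map (laurent_monom (map_prod int int u)) = monom_vec u"
  by (cases u) (simp add: vec_eq_iff eval_map_def monom_vec_def laurent_monom_def laurent_eval_def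
      case_prod_unfold)

lemma toric_code_eq_span:
  assumes "lattice_points P = map_prod int int ` N"
  shows "toric_code P = vec.span (monom_vec ` N)"
proof -
  interpret Vector_Spaces.linear laurent_scale "(*s)"
    "eval_map :: 'a::{field,finite} laurent \<Rightarrow> 'a ^ 'a torus"
    by (rule eval_map_linear)
  show ?thesis
    unfolding toric_code_def assms span_image[symmetric] image_image eval_map_laurent_monom ..
qed

text \<open>Transfers counting from the subtype \<open>torus\<close> to pairs of nonzero field
  elements, where the grid bound and product sets are available.\<close>

lemma card_torus_Collect:
  "card {t :: 'a::{field,finite} torus. R (Rep_torus t)}
    = card {(x, y). x \<in> UNIV - {0} \<and> y \<in> UNIV - {0::'a} \<and> R (x, y)}"
proof (rule bij_betw_same_card[of Rep_torus], unfold bij_betw_def, intro conjI)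
  show "inj_on Rep_torus {t :: 'a torus. R (Rep_torus t)}"
    by (simp add: inj_on_def Rep_torus_inject)
  show "Rep_torus ` {t :: 'a torus. R (Rep_torus t)}
    = {(x, y). x \<in> UNIV - {0} \<and> y \<in> UNIV - {0::'a} \<and> R (x, y)}"
  proof (intro equalityI subsetI)
    fix z assume "z \<in> Rep_torus ` {t :: 'a torus. R (Rep_torus t)}"
    then show "z \<in> {(x, y). x \<in> UNIV - {0} \<and> y \<in> UNIV - {0} \<and> R (x, y)}"
      using Rep_torus[where 'a = 'a] by (auto simp: mem_Times_iff prod_eq_iff)
  next
    fix z assume "z \<in> {(x, y). x \<in> UNIV - {0} \<and> y \<in> UNIV - {0::'a} \<and> R (x, y)}"
    then show "z \<in> Rep_torus ` {t. R (Rep_torus t)}"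
      by (intro image_eqI[of _ _ "Abs_torus z"]) (auto simp: Abs_torus_inverse)
  qed
qed

lemma card_torus: "CARD('a::{field,finite} torus) = (CARD('a) - 1)\<^sup>2"
proof -
  have "CARD('a torus) = card ((UNIV - {0::'a}) \<times> (UNIV - {0::'a}))"
    using card_torus_Collect[where 'a = 'a and R = "\<lambda>_. True"]
    by (simp add: Sigma_def case_prod_unfold) (rule arg_cong[where f = card], auto)
  then show ?thesis by (simp only: card_cartesian_product power2_eq_square card_Diff_singleton UNIV_I)
qed

section \<open>Codeword weights: lower bound and extremal products\<close>

lemma hamming_weight_combination_ge:
  fixes c :: "nat \<times> nat \<Rightarrow> 'a::{field,finite}"
  defines "Q \<equiv> CARD('a) - 1"
  assumes "d < Q" "e + r * d < Q" "u \<in> trapezoid d e r" "c u \<noteq> 0"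
  shows "min ((Q - d) * (Q - e)) (Q * (Q - e - r * d))
    \<le> hamming_weight (\<Sum>u\<in>trapezoid d e r. c u *s monom_vec u)"
proof -
  let ?N = "trapezoid d e r"
  \<comment> \<open>The combination becomes a bivariate polynomial with y outermost, whose values on
    the torus are the coordinates of the codeword. The nonzero \<open>c u\<close> makes
    \<open>G\<close> nonzero, so the grid bound applies with both sides equal to the nonzero field
    elements.\<close>
  define G where "G = (\<Sum>u\<in>?N. monom (monom (c u) (fst u)) (snd u))"
  have coeff_G: "coeff (coeff G j) i = (if (i, j) \<in> ?N then c (i, j) else 0)" for i j
  proof -
    have "coeff (coeff G j) i = (\<Sum>u\<in>?N. if u = (i, j) then c u else 0)"
      unfolding G_def coeff_sum by (intro sum.cong) (auto simp: prod_eq_iff)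
    then show ?thesis by (simp add: sum.delta)
  qed
  have nz: "G \<noteq> 0"
    using assms coeff_G[of "snd u" "fst u"] by auto
  have tr: "in_trapezoid d e r G"
    by (auto simp: in_trapezoid_def coeff_G trapezoid_def)
  have eval_G: "eval2 G x y = (\<Sum>u\<in>?N. c u * (x ^ fst u * y ^ snd u))" for x y
    by (simp add: G_def eval2_def poly_sum poly_monom mult.assoc flip: poly_const_pow)
  have Q: "card (UNIV - {0::'a}) = Q" by (simp add: Q_def card_Diff_singleton)
  obtain k where k: "k \<le> d" "(Q - k) * (Q - (e + r * (d - k)))
    \<le> card {(x, y). x \<in> UNIV - {0} \<and> y \<in> UNIV - {0} \<and> eval2 G x y \<noteq> 0}"
    using card_nonzeros_grid_ge[OF nz tr, of "UNIV - {0}" "UNIV - {0}"] Q by auto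
  have "hamming_weight (\<Sum>u\<in>?N. c u *s monom_vec u)
    = card {t. eval2 G (fst (Rep_torus t)) (snd (Rep_torus t)) \<noteq> 0}"
    unfolding hamming_weight_def eval_G by (simp add: monom_vec_def)
  also have "\<dots> = card {(x, y). x \<in> UNIV - {0} \<and> y \<in> UNIV - {0} \<and> eval2 G x y \<noteq> 0}"
    using card_torus_Collect[of "\<lambda>z. eval2 G (fst z) (snd z) \<noteq> 0"] by simp
  finally show ?thesis
    using k min_endpoints_le[OF k(1) assms(2,3)] by linarith
qed

text \<open>Expanding the product of the two sums gives one monomial for each pair of exponents, and
  a product is nonzero exactly when both factors are, so the nonzero coordinates form a product
  set.\<close>

lemma product_codeword:
  fixes p h :: "'a::{field,finite} poly"
  assumes "\<And>i j. coeff p i \<noteq> 0 \<Longrightarrow> coeff h j \<noteq> 0 \<Longrightarrow> (i, j) \<in> N"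
  defines "w \<equiv> (\<chi> t. poly p (fst (Rep_torus t)) * poly h (snd (Rep_torus t))) :: 'a ^ 'a torus"
  shows "w \<in> vec.span (monom_vec ` N)"
    and "hamming_weight w = card {x. x \<noteq> 0 \<and> poly p x \<noteq> 0} * card {y. y \<noteq> 0 \<and> poly h y \<noteq> 0}"
proof -
  have "w = (\<Sum>i\<le>degree p. \<Sum>j\<le>degree h. (coeff p i * coeff h j) *s monom_vec (i, j))"
    by (simp add: vec_eq_iff w_def monom_vec_def poly_altdef sum_product, simp add: mult_ac)
  also have "\<dots> \<in> vec.span (monom_vec ` N)"
  proof (intro vec.span_sum)
    fix i j
    show "(coeff p i * coeff h j) *s (monom_vec (i, j) :: 'a ^ 'a torus) \<in> vec.span (monom_vec ` N)"
    proof (cases "coeff p i = 0 \<or> coeff h j = 0")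
      case True
      then show ?thesis by (auto simp: vec.span_zero)
    next
      case False
      then show ?thesis using assms(1) by (intro vec.span_scale vec.span_base) auto
    qed
  qed
  finally show "w \<in> vec.span (monom_vec ` N)" .
  have "hamming_weight w = card {(x, y). x \<in> UNIV - {0} \<and> y \<in> UNIV - {0} \<and> poly p x * poly h y \<noteq> 0}"
    using card_torus_Collect[of "\<lambda>z. poly p (fst z) * poly h (snd z) \<noteq> 0"]
    by (simp add: hamming_weight_def w_def)
  also have "{(x, y). x \<in> UNIV - {0} \<and> y \<in> UNIV - {0} \<and> poly p x * poly h y \<noteq> 0}
    = {x. x \<noteq> 0 \<and> poly p x \<noteq> 0} \<times> {y. y \<noteq> 0 \<and> poly h y \<noteq> 0}" by auto
  finally show "hamming_weight w
    = card {x. x \<noteq> 0 \<and> poly p x \<noteq> 0} * card {y. y \<noteq> 0 \<and> poly h y \<noteq> 0}"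
    by (simp add: card_cartesian_product)
qed

lemma poly_with_nonzero_roots:
  assumes "n \<le> CARD('a::{field,finite}) - 1"
  obtains p :: "'a::{field,finite} poly" where "degree p = n"
    and "card {x. x \<noteq> 0 \<and> poly p x \<noteq> 0} = CARD('a) - 1 - n"
proof -
  have "n \<le> card (UNIV - {0::'a})" using assms by (simp add: card_Diff_singleton)
  then obtain S where S: "S \<subseteq> UNIV - {0::'a}" "card S = n"
    by (metis obtain_subset_with_card_n)
  let ?p = "\<Prod>a\<in>S. [:-a, 1:]"
  have "degree ?p = n" using S by (subst degree_prod_eq_sum_degree) auto
  moreover have "{x. x \<noteq> 0 \<and> poly ?p x \<noteq> 0} = (UNIV - {0}) - S"
    by (auto simp: poly_prod)
  then have "card {x. x \<noteq> 0 \<and> poly ?p x \<noteq> 0} = CARD('a) - 1 - n"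
    using S by (simp add: card_Diff_subset card_Diff_singleton)
  ultimately show ?thesis by (rule that)
qed

section \<open>Length, dimension and minimum distance of the toric code\<close>

theorem theorem3p1:
  fixes q d e r :: nat
    and P :: "(real \<times> real) set"
    and C :: "('a::{field,finite} ^ 'a torus) set"
  assumes "CARD('a) = q"
    and "d > 0" and "e > 0" and "r > 0"
    and "P = convex hull {(0, 0), (real d, 0), (real d, real (e + r * d)), (0, real e)}"
    and "d < q - 1" and "e < q - 1" and "e + r * d < q - 1"
    and "C = toric_code P"
  shows "code_length C = (q - 1)\<^sup>2
    \<and> vec.dim C = card (lattice_points P)
    \<and> card (lattice_points P) = (d + 1) * (e + 1) + r * (d * (d + 1) div 2)
    \<and> min_distance C = min ((q - 1 - d) * (q - 1 - e)) ((q - 1) * (q - 1 - e - r * d))"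
proof -
  define N where "N = trapezoid d e r"
  define v where "v = (monom_vec :: nat \<times> nat \<Rightarrow> 'a ^ 'a torus)"
  define \<delta> where "\<delta> = min ((q - 1 - d) * (q - 1 - e)) ((q - 1) * (q - 1 - e - r * d))"
  have L: "lattice_points P = map_prod int int ` N"
    unfolding assms(5) N_def by (rule lattice_points_trapezoid[OF assms(2)])
  have "inj (map_prod int int)" by (intro prod.inj_map) (auto simp: inj_def)
  then have card_L: "card (lattice_points P) = card N"
    unfolding L by (intro card_image) (auto intro: inj_on_subset)
  have C: "C = vec.span (v ` N)" unfolding assms(9) v_def by (rule toric_code_eq_span[OF L])
  have \<delta>_pos: "\<delta> > 0" using assms(6-8) unfolding \<delta>_def by (intro min_less_iff_conj[THEN iffD2] conjI mult_pos_pos) linarith+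
  have weight: "\<delta> \<le> hamming_weight (\<Sum>u\<in>N. c u *s v u)" if "u \<in> N" "c u \<noteq> 0" for c u
    unfolding \<delta>_def N_def v_def assms(1)[symmetric]
    using hamming_weight_combination_ge[of d e r u c] that assms by (simp add: N_def)
  \<comment> \<open>The zero vector has weight 0, which is below the positive bound
    \<open>\<delta>\<close>; hence no nontrivial relation exists.\<close>
  have indep: "c u = 0" if "(\<Sum>u\<in>N. c u *s v u) = 0" "u \<in> N" for c u
    using weight[OF that(2), of c] \<delta>_pos that(1) by (auto simp: hamming_weight_def)
  have fin: "finite N" by (simp add: N_def)
  \<comment> \<open>Two equal monomial vectors would give a relation with coefficients 1 and -1.
    Injectivity then allows sums over the image of \<open>N\<close> to be reindexed by
    \<open>N\<close>.\<close>
  have inj: "inj_on v N"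
  proof (rule inj_onI, rule ccontr)
    fix a b assume ab: "a \<in> N" "b \<in> N" "v a = v b" "a \<noteq> b"
    define c :: "nat \<times> nat \<Rightarrow> 'a" where "c = (\<lambda>u. if u = a then 1 else if u = b then - 1 else 0)"
    have "(\<Sum>u\<in>N. c u *s v u) = (\<Sum>u\<in>{a, b}. c u *s v u)"
      using ab fin by (intro sum.mono_neutral_right) (auto simp: c_def)
    also have "\<dots> = 0" using ab by (simp add: c_def)
    finally show False using indep[of c a] ab(1) by (simp add: c_def)
  qed
  have "vec.independent (v ` N)"
  proof
    assume "vec.dependent (v ` N)"
    then obtain g where g: "\<exists>w\<in>v ` N. g w \<noteq> 0" "(\<Sum>w\<in>v ` N. g w *s w) = 0"
      using fin by (auto simp: vec.dependent_finite)
    have "(\<Sum>u\<in>N. g (v u) *s v u) = 0" using g(2) inj by (simp add: sum.reindex)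
    then show False using indep[of "\<lambda>u. g (v u)"] g(1) by auto
  qed
  from vec.dim_span_eq_card_independent[OF this] have dim: "vec.dim C = card N"
    using inj by (simp only: C card_image)
  have "min_distance C = \<delta>"
    unfolding min_distance_def
  proof (rule Min_eqI)
    show "finite (hamming_weight ` (C - {0}))" by simp
  next
    fix y assume "y \<in> hamming_weight ` (C - {0})"
    then obtain w where w: "w \<in> C" "w \<noteq> 0" "y = hamming_weight w" by auto
    then obtain g where "w = (\<Sum>x\<in>v ` N. g x *s x)"
      using C fin by (auto simp: vec.span_finite)
    then have g: "w = (\<Sum>u\<in>N. g (v u) *s v u)" using inj by (simp add: sum.reindex)
    then obtain u where "u \<in> N" "g (v u) \<noteq> 0" using w(2)
      by (metis (no_types, lifting) sum.neutral vec.scale_zero_left)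
    then show "\<delta> \<le> y" using weight[of u "\<lambda>u. g (v u)"] w g by simp
  next
    \<comment> \<open>Positivity of the weight ensures that the product codeword is not the excluded
      zero vector.\<close>
    have attained: "card {x. x \<noteq> 0 \<and> poly p x \<noteq> 0} * card {y. y \<noteq> 0 \<and> poly h y \<noteq> 0}
        \<in> hamming_weight ` (C - {0})"
      if "\<And>i j. coeff p i \<noteq> 0 \<Longrightarrow> coeff h j \<noteq> 0 \<Longrightarrow> (i, j) \<in> N"
        and pos: "card {x. x \<noteq> 0 \<and> poly p x \<noteq> 0} * card {y. y \<noteq> 0 \<and> poly h y \<noteq> 0} > 0"
      for p h :: "'a poly"
    proof -
      define w :: "'a ^ 'a torus"
        where "w = (\<chi> t. poly p (fst (Rep_torus t)) * poly h (snd (Rep_torus t)))"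
      have w: "w \<in> C" "hamming_weight w
          = card {x. x \<noteq> 0 \<and> poly p x \<noteq> 0} * card {y. y \<noteq> 0 \<and> poly h y \<noteq> 0}"
        using product_codeword[of p h N] that(1) unfolding C w_def v_def by auto
      have "hamming_weight (0 :: 'a ^ 'a torus) = 0" by (simp add: hamming_weight_def)
      then have "w \<noteq> 0" using w(2) pos by (metis less_irrefl)
      with w show ?thesis by (metis DiffI image_eqI singletonD)
    qed
    \<comment> \<open>\<open>p1\<close> and \<open>h1\<close> attain the bound at k = d: their
      product is supported in the rectangle of sides \<open>d\<close> and \<open>e\<close>, which
      lies inside the trapezoid.\<close>
    obtain p1 :: "'a poly" where p1: "degree p1 = d"
      "card {x. x \<noteq> 0 \<and> poly p1 x \<noteq> 0} = q - 1 - d"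
      using poly_with_nonzero_roots[where 'a = 'a and n = d] assms(1,6-8) by auto
    obtain h1 :: "'a poly" where h1: "degree h1 = e"
      "card {x. x \<noteq> 0 \<and> poly h1 x \<noteq> 0} = q - 1 - e"
      using poly_with_nonzero_roots[where 'a = 'a and n = e] assms(1,6-8) by auto
    \<comment> \<open>The bound at k = 0 is attained by x^d times \<open>h2\<close>: the column of
      exponent \<open>d\<close> admits degree \<open>e + r * d\<close> in y, and x^d has no zero on
      the torus, which leaves the full factor \<open>q - 1\<close>.\<close>
    obtain h2 :: "'a poly" where h2: "degree h2 = e + r * d"
      "card {x. x \<noteq> 0 \<and> poly h2 x \<noteq> 0} = q - 1 - (e + r * d)"
      using poly_with_nonzero_roots[where 'a = 'a and n = "e + r * d"] assms(1,6-8) by auto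
    have "{x. x \<noteq> 0 \<and> poly (monom (1::'a) d) x \<noteq> 0} = UNIV - {0}"
      by (auto simp: poly_monom)
    then have p2: "card {x. x \<noteq> 0 \<and> poly (monom (1::'a) d) x \<noteq> 0} = q - 1"
      using assms(1) by (simp add: card_Diff_singleton)
    have q: "Suc d < q" "Suc e < q" "Suc 0 < q" "Suc (e + r * d) < q"
      using assms(6-8) by linarith+
    have "(i, j) \<in> N" if "coeff p1 i \<noteq> 0" "coeff h1 j \<noteq> 0" for i j
      using le_degree[OF that(1)] le_degree[OF that(2)] p1(1) h1(1)
      by (simp add: N_def trapezoid_def)
    then have "(q - 1 - d) * (q - 1 - e) \<in> hamming_weight ` (C - {0})"
      using attained[of p1 h1] p1(2) h1(2) q by simp
    moreover have "(i, j) \<in> N" if "coeff (monom (1::'a) d) i \<noteq> 0" "coeff h2 j \<noteq> 0" for i j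
      using that(1) le_degree[OF that(2)] h2(1)
      by (simp add: N_def trapezoid_def split: if_splits)
    then have "(q - 1) * (q - 1 - e - r * d) \<in> hamming_weight ` (C - {0})"
      using attained[of "monom 1 d" h2] p2 h2(2) q by simp
    ultimately show "\<delta> \<in> hamming_weight ` (C - {0})"
      unfolding \<delta>_def min_def by simp
  qed
  then show ?thesis
    using dim card_L card_trapezoid[of d e r] card_torus[where 'a = 'a] assms(1)
    by (simp add: \<delta>_def N_def code_length_def)
qed

end
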